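(* Let $d,z>0$ be real numbers, let $s\in\{0,1\}$, and set $c^s_d=\frac{d\,e^{-is\frac{\pi}{4}}}{2\sqrt{\pi}}$. Then $$[c^s_d]^{-1}\; e^{(-1)^{s+1}\, i^s\, d\, \sqrt{z}} =\int_0^\infty \frac{dl}{l^{3/2}}\; e^{(-1)^{1+s}\, i^s\, \left[z\,l+\frac{d^2}{4l}\right]} .$$
   Context: Here $i$ is the imaginary unit, $i^0=1$, $i^1=i$, and $\sqrt{z}$, $l^{3/2}$ are the positive roots. For $s=0$ the integral converges absolutely. For $s=1$ the integral is understood as a (conditionally convergent, oscillatory) improper integral, $\lim_{\epsilon\to 0+,\,L\to\infty}\int_\epsilon^L$. *)

theory Defs
  imports "HOL-Analysis.Analysis"
begin

definition c_coeff :: "nat \<Rightarrow> real \<Rightarrow> complex" where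
  "c_coeff s d = complex_of_real d * exp (- \<i> * of_nat s * complex_of_real pi / 4)
                   / (2 * complex_of_real (sqrt pi))"

definition phase_integrand :: "nat \<Rightarrow> real \<Rightarrow> real \<Rightarrow> real \<Rightarrow> complex" where
  "phase_integrand s d z l =
     exp ((-1) ^ (1 + s) * \<i> ^ s * complex_of_real (z * l + d\<^sup>2 / (4 * l)))
       / complex_of_real (l powr (3/2))"

(* The limits at 0+ and at infinity are taken jointly and independently of each other
   (product filter).  Local integrability is demanded because the Lebesgue integral of
   a non-integrable function is 0 by convention. *)
definition has_improper_integral_0_inf :: "(real \<Rightarrow> complex) \<Rightarrow> complex \<Rightarrow> bool" where
  "has_improper_integral_0_inf f I \<longleftrightarrow>
     (\<forall>\<epsilon> L. 0 < \<epsilon> \<and> \<epsilon> \<le> L \<longrightarrow> set_integrable lborel {\<epsilon>..L} f) \<and>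
     ((\<lambda>(\<epsilon>, L). LBINT l:{\<epsilon>..L}. f l) \<longlongrightarrow> I) (at_right 0 \<times>\<^sub>F at_top)"

(* s = 0: absolutely convergent Lebesgue integral;  s = 1: improper integral,
   since the integrand is not absolutely integrable near 0. *)
definition has_phase_integral :: "nat \<Rightarrow> (real \<Rightarrow> complex) \<Rightarrow> complex \<Rightarrow> bool" where
  "has_phase_integral s f I \<longleftrightarrow>
     (if s = 0 then set_integrable lborel {0<..} f \<and> (LBINT l:{0<..}. f l) = I
      else has_improper_integral_0_inf f I)"

end

(* Let E be the entire primitive of exp (-t^2) with E 0 = 0. With a = k sqrt z, b = k d / 2 and
   u = b / sqrt l - a sqrt l, v = b / sqrt l + a sqrt l, the function
     - (exp (-2ab) E u + exp (2ab) E v) / b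
   of l is a primitive of l^(-3/2) exp (-k^2 (z l + d^2/(4l))) for every nonzero complex k; here
   k = exp (-i s pi / 4). The arguments u and v run to infinity along the ray spanned by k (or its
   opposite), so the integral is determined by the limit of E along that ray. For s = 0 this is
   the Gaussian integral sqrt pi / 2, and a contour rotation gives the same limit for s = 1. *)
theory Submission
  imports Defs "HOL-Complex_Analysis.Cauchy_Integral_Theorem" "HOL-Probability.Distributions"
    "HOL-Real_Asymp.Real_Asymp"
begin

section \<open>The entire primitive of the Gaussian\<close>

text \<open>This is E of the overview, that is, \<open>sqrt pi / 2\<close> times the complex error
  function. The choice of the segment is immaterial, since the integrand is entire.\<close>

definition gauss_int :: "complex \<Rightarrow> complex" where
  "gauss_int w = contour_integral (linepath 0 w) (\<lambda>t. exp (- t\<^sup>2))"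

lemma has_field_derivative_gauss_int:
  "(gauss_int has_field_derivative exp (- w\<^sup>2)) (at w)"
proof -
  have "(\<lambda>t::complex. exp (- t\<^sup>2)) holomorphic_on UNIV"
    by (intro holomorphic_intros)
  then obtain g where g: "\<And>t::complex. (g has_field_derivative exp (- t\<^sup>2)) (at t)"
    using holomorphic_convex_primitive'[of UNIV "\<lambda>t. exp (- t\<^sup>2)"] by auto
  have "gauss_int w = g w - g 0" for w
    unfolding gauss_int_def
    using contour_integral_primitive[of UNIV g "\<lambda>t. exp (- t\<^sup>2)" "linepath 0 w"] g
    by (simp add: contour_integral_unique)
  hence "gauss_int = (\<lambda>w. g w - g 0)" by (rule ext)
  moreover have "((\<lambda>w. g w - g 0) has_field_derivative exp (- w\<^sup>2)) (at w)"
    using DERIV_diff[OF g DERIV_const] by simp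
  ultimately show ?thesis by (simp only:)
qed

lemma gauss_int_0 [simp]: "gauss_int 0 = 0"
  by (simp add: gauss_int_def)

text \<open>As \<open>exp (- t\<^sup>2)\<close> is even, the sum of both values has derivative 0;
  the constant is read off at 0.\<close>

lemma gauss_int_minus: "gauss_int (- w) = - gauss_int w"
proof -
  have "((\<lambda>w. gauss_int w + gauss_int (- w)) has_field_derivative 0) (at w)" for w
    by (rule derivative_eq_intros has_field_derivative_gauss_int
         DERIV_chain2[OF has_field_derivative_gauss_int] refl)+ simp
  then obtain c where c: "\<And>w. gauss_int w + gauss_int (- w) = c"
    using has_field_derivative_zero_constant[of UNIV "\<lambda>w. gauss_int w + gauss_int (- w)"] by auto
  from c[of 0] c[of w] show ?thesis
    by (simp add: add_eq_0_iff)
qed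

lemma has_vector_derivative_gauss_int_chain:
  assumes "(g has_vector_derivative g') (at t)"
  shows "((\<lambda>t. gauss_int (g t)) has_vector_derivative (g' * exp (- (g t)\<^sup>2))) (at t)"
  using field_vector_diff_chain_at[OF assms has_field_derivative_gauss_int]
  by (simp add: o_def)

section \<open>Limits along the real axis and along the ray of argument - pi / 4\<close>

text \<open>The half-line Gaussian integral is the limit of its truncations at \<open>y\<close>, and
  for \<open>y \<ge> 0\<close> the fundamental theorem identifies each truncation with a value of
  \<open>gauss_int\<close>.\<close>

lemma gauss_int_tendsto_at_top:
  "((\<lambda>x. gauss_int (complex_of_real x)) \<longlongrightarrow> complex_of_real (sqrt pi / 2)) at_top"
proof -
  let ?f = "\<lambda>x::real. indicator {0..} x *\<^sub>R exp (- x\<^sup>2)"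
  have lim: "((\<lambda>y. \<integral>x. indicator {..y} x *\<^sub>R ?f x \<partial>lborel) \<longlongrightarrow> sqrt pi / 2) at_top"
    using tendsto_integral_at_top[of lborel ?f] gaussian_moment_0
    unfolding has_bochner_integral_iff by (metis sets_lborel)
  have eq: "complex_of_real (\<integral>x. indicator {..y} x *\<^sub>R ?f x \<partial>lborel) = gauss_int (complex_of_real y)"
    if "y \<ge> 0" for y
  proof -
    have "complex_of_real (\<integral>x. indicator {..y} x *\<^sub>R ?f x \<partial>lborel) =
          (\<integral>x. complex_of_real (indicator {..y} x *\<^sub>R ?f x) \<partial>lborel)"
      by (rule integral_complex_of_real[symmetric])
    also have "\<dots> = (\<integral>x. indicator {0..y} x *\<^sub>R exp (- (complex_of_real x)\<^sup>2) \<partial>lborel)"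
      by (intro Bochner_Integration.integral_cong)
         (auto simp: indicator_def exp_of_real[symmetric])
    also have "\<dots> = gauss_int (complex_of_real y) - gauss_int (complex_of_real 0)"
    proof (rule integral_FTC_atLeastAtMost)
      show "((\<lambda>x. gauss_int (complex_of_real x)) has_vector_derivative
              exp (- (complex_of_real x)\<^sup>2)) (at x within {0..y})" for x
        using has_vector_derivative_at_within[OF has_vector_derivative_gauss_int_chain[OF
          has_vector_derivative_of_real[OF DERIV_ident[unfolded has_real_derivative_iff_has_vector_derivative]]]]
        by simp
    qed (use that in \<open>auto intro!: continuous_intros\<close>)
    finally show ?thesis by simp
  qed
  show ?thesis
  proof (rule Lim_transform_eventually[OF tendsto_of_real[OF lim]])
    show "\<forall>\<^sub>F y in at_top. complex_of_real (\<integral>x. indicator {..y} x *\<^sub>R ?f x \<partial>lborel) =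
            gauss_int (complex_of_real y)"
      using eventually_ge_at_top[of 0] by eventually_elim (rule eq)
  qed
qed

text \<open>On the segment from \<open>R\<close> to \<open>R - \<i>R\<close> the integrand \<open>exp (- t\<^sup>2)\<close> has modulus
  \<open>exp (y\<^sup>2 - R\<^sup>2) \<le> exp (R * (y - R))\<close>, so the contour can be turned from the real axis
  to the ray of argument \<open>- pi / 4\<close>.\<close>

lemma norm_gauss_int_rotate_le:
  assumes "R > 0"
  shows "norm (gauss_int (Complex R (- R)) - gauss_int (complex_of_real R)) \<le> 1 / R"
proof -
  let ?h = "\<lambda>y. complex_of_real R - \<i> * complex_of_real y"
  \<comment> \<open>An elementary primitive of the bound \<open>exp (R * (y - R))\<close>; the mean
    value inequality compares the curve with its increment over \<open>{0..R}\<close>.\<close>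
  let ?\<phi> = "\<lambda>y. exp (R * (y - R)) / R"
  have d: "((\<lambda>y. gauss_int (?h y)) has_vector_derivative (- \<i> * exp (- (?h y)\<^sup>2))) (at y)" for y
    by (rule has_vector_derivative_gauss_int_chain) (auto intro!: derivative_eq_intros)
  have "norm (gauss_int (?h R) - gauss_int (?h 0)) \<le> ?\<phi> R - ?\<phi> 0"
  proof (rule differentiable_bound_general[OF assms _ _ d])
    show "continuous_on {0..R} (\<lambda>y. gauss_int (?h y))"
      using has_vector_derivative_continuous[OF d] by (blast intro: continuous_at_imp_continuous_on)
    show "continuous_on {0..R} ?\<phi>"
      using assms by (auto intro!: continuous_intros)
    show "(?\<phi> has_vector_derivative exp (R * (y - R))) (at y)" for y
      using assms unfolding has_real_derivative_iff_has_vector_derivative[symmetric]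
      by (auto intro!: derivative_eq_intros)
    show "norm (- \<i> * exp (- (?h y)\<^sup>2)) \<le> exp (R * (y - R))" if "0 < y" "y < R" for y
    proof -
      have "norm (- \<i> * exp (- (?h y)\<^sup>2)) = exp (y\<^sup>2 - R\<^sup>2)"
        by (simp add: norm_mult norm_exp_eq_Re power2_eq_square)
      also have "y\<^sup>2 - R\<^sup>2 = (R + y) * (y - R)"
        by (simp add: algebra_simps power2_eq_square)
      also have "\<dots> \<le> R * (y - R)"
        using that by (intro mult_right_mono_neg) auto
      finally show ?thesis by simp
    qed
  qed
  also have "\<dots> \<le> 1 / R"
    using assms by simp
  also have "?h R = Complex R (- R)"
    by (simp add: complex_eq_iff)
  finally show ?thesis by simp
qed

text \<open>On this ray \<open>exp (- t\<^sup>2)\<close> has modulus 1, so nothing converges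
  absolutely. The limit is carried over from the real axis, because the vertical segment contributes
  at most \<open>1 / R\<close>. Its end point lies on the ray at distance \<open>R * sqrt 2\<close>
  from 0, whence the substitution \<open>R = x / sqrt 2\<close>.\<close>

lemma gauss_int_tendsto_rotated:
  "((\<lambda>x. gauss_int (exp (- \<i> * complex_of_real pi / 4) * complex_of_real x))
     \<longlongrightarrow> complex_of_real (sqrt pi / 2)) at_top"
proof -
  have 1: "((\<lambda>R. gauss_int (Complex R (- R)) - gauss_int (complex_of_real R)) \<longlongrightarrow> 0) at_top"
  proof (rule Lim_null_comparison)
    show "\<forall>\<^sub>F R in at_top. norm (gauss_int (Complex R (- R)) - gauss_int (complex_of_real R)) \<le> 1 / R"
      using eventually_gt_at_top[of 0] by eventually_elim (rule norm_gauss_int_rotate_le)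
    show "((\<lambda>R::real. 1 / R) \<longlongrightarrow> 0) at_top"
      by real_asymp
  qed
  have 2: "((\<lambda>R. gauss_int (Complex R (- R))) \<longlongrightarrow> complex_of_real (sqrt pi / 2)) at_top"
    using tendsto_add[OF 1 gauss_int_tendsto_at_top] by simp
  have 3: "filterlim (\<lambda>x::real. x / sqrt 2) at_top at_top"
    by real_asymp
  have "exp (- \<i> * complex_of_real pi / 4) * complex_of_real x = Complex (x / sqrt 2) (- (x / sqrt 2))" for x
  proof -
    have "exp (- \<i> * complex_of_real pi / 4) = cis (- (pi / 4))"
      by (simp add: cis_conv_exp)
    moreover have "sqrt 2 / 2 = 1 / sqrt 2"
      by (simp add: real_div_sqrt field_simps)
    ultimately show ?thesis
      by (simp only: complex_eq_iff) (simp add: cos_45 sin_45)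
  qed
  thus ?thesis
    using filterlim_compose[OF 2 3] by simp
qed

section \<open>A primitive of the integrand\<close>

text \<open>With k = \<open>\<kappa>\<close>, 2ab is \<open>\<kappa>\<^sup>2 * d * sqrt z\<close>
  and 1/b is \<open>2 / (\<kappa> * d)\<close>. The factor \<open>\<kappa>\<close> is pulled out of
  u and v, so that a real parameter runs along the line spanned by \<open>\<kappa>\<close>.\<close>

definition phase_antideriv :: "complex \<Rightarrow> real \<Rightarrow> real \<Rightarrow> real \<Rightarrow> complex" where
  "phase_antideriv \<kappa> d z l = - (2 / (\<kappa> * complex_of_real d)) *
     (exp (- (\<kappa>\<^sup>2 * complex_of_real (d * sqrt z))) *
        gauss_int (\<kappa> * complex_of_real (d / (2 * sqrt l) - sqrt z * sqrt l)) +
      exp (\<kappa>\<^sup>2 * complex_of_real (d * sqrt z)) *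
        gauss_int (\<kappa> * complex_of_real (d / (2 * sqrt l) + sqrt z * sqrt l)))"

text \<open>The prefactors cancel the cross terms -2ab and 2ab of the squares of u and v, so both
  summands carry the same exponential. In u' + v' the a-terms cancel and -b / l^(3/2) remains, which
  the factor -1/b normalises.\<close>

lemma has_vector_derivative_phase_antideriv:
  assumes "\<kappa> \<noteq> 0" "d > 0" "z > 0" "l > 0"
  shows "(phase_antideriv \<kappa> d z has_vector_derivative
           exp (- (\<kappa>\<^sup>2 * complex_of_real (z * l + d\<^sup>2 / (4 * l)))) / complex_of_real (l powr (3/2))) (at l)"
proof -
  \<comment> \<open>Both summands are treated at once: \<open>\<sigma> = - sqrt z\<close> gives the
    one with u, \<open>\<sigma> = sqrt z\<close> the one with v.\<close>
  have part: "((\<lambda>l. exp (\<kappa>\<^sup>2 * complex_of_real (d * \<sigma>)) *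
                gauss_int (\<kappa> * complex_of_real (d / (2 * sqrt l) + \<sigma> * sqrt l))) has_vector_derivative
              \<kappa> * complex_of_real (\<sigma> / (2 * sqrt l) - d / (4 * (l * sqrt l))) *
                exp (- (\<kappa>\<^sup>2 * complex_of_real (z * l + d\<^sup>2 / (4 * l))))) (at l)"
    (is "(?g has_vector_derivative _) _") if "\<sigma>\<^sup>2 = z" for \<sigma>
  proof -
    define u where "u = (\<lambda>l. d / (2 * sqrt l) + \<sigma> * sqrt l)"
    have "(u has_real_derivative (\<sigma> / (2 * sqrt l) - d / (4 * (l * sqrt l)))) (at l)"
      unfolding u_def using assms
      by (auto intro!: derivative_eq_intros simp: field_simps)
    hence "((\<lambda>l. \<kappa> * complex_of_real (u l)) has_vector_derivative
             \<kappa> * complex_of_real (\<sigma> / (2 * sqrt l) - d / (4 * (l * sqrt l)))) (at l)"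
      by (intro has_vector_derivative_mult_right has_vector_derivative_of_real)
         (simp add: has_real_derivative_iff_has_vector_derivative)
    from has_vector_derivative_mult_right[OF has_vector_derivative_gauss_int_chain[OF this],
        of "exp (\<kappa>\<^sup>2 * complex_of_real (d * \<sigma>))"]
    have "(?g has_vector_derivative
             exp (\<kappa>\<^sup>2 * complex_of_real (d * \<sigma>)) *
              (\<kappa> * complex_of_real (\<sigma> / (2 * sqrt l) - d / (4 * (l * sqrt l))) *
               exp (- (\<kappa> * complex_of_real (u l))\<^sup>2))) (at l)"
      by (simp add: u_def)
    moreover have "exp (\<kappa>\<^sup>2 * complex_of_real (d * \<sigma>)) * exp (- (\<kappa> * complex_of_real (u l))\<^sup>2) =
                   exp (- (\<kappa>\<^sup>2 * complex_of_real (z * l + d\<^sup>2 / (4 * l))))"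
    proof -
      have "(u l)\<^sup>2 = d * \<sigma> + (z * l + d\<^sup>2 / (4 * l))"
        using assms that by (simp add: u_def power2_sum power_mult_distrib power_divide field_simps)
      hence "(\<kappa> * complex_of_real (u l))\<^sup>2 =
             \<kappa>\<^sup>2 * complex_of_real (d * \<sigma>) + \<kappa>\<^sup>2 * complex_of_real (z * l + d\<^sup>2 / (4 * l))"
        by (simp only: power_mult_distrib of_real_power[symmetric] of_real_add distrib_left)
      thus ?thesis
        by (simp only: exp_add[symmetric]) simp
    qed
    ultimately show ?thesis
      by (metis (no_types, lifting) mult.assoc mult.left_commute)
  qed
  have powr: "l powr (3/2) = l * sqrt l"
    using assms powr_add[of l 1 "1/2"] by (simp add: powr_half_sqrt)
  have "- (2 / (\<kappa> * complex_of_real d)) *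
         (\<kappa> * complex_of_real ((- sqrt z) / (2 * sqrt l) - d / (4 * (l * sqrt l))) * e +
          \<kappa> * complex_of_real (sqrt z / (2 * sqrt l) - d / (4 * (l * sqrt l))) * e) =
        e / complex_of_real (l powr (3/2))" for e
  proof -
    have "\<kappa> * complex_of_real ((- sqrt z) / (2 * sqrt l) - d / (4 * (l * sqrt l))) * e +
          \<kappa> * complex_of_real (sqrt z / (2 * sqrt l) - d / (4 * (l * sqrt l))) * e =
          \<kappa> * e * complex_of_real (- (d / (2 * (l * sqrt l))))"
      by (simp add: algebra_simps flip: of_real_add)
    also have "- (2 / (\<kappa> * complex_of_real d)) * \<dots> = e / complex_of_real (l powr (3/2))"
      using assms by (simp add: powr field_simps)
    finally show ?thesis .
  qed
  moreover have "phase_antideriv \<kappa> d z = (\<lambda>l. - (2 / (\<kappa> * complex_of_real d)) *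
     (exp (\<kappa>\<^sup>2 * complex_of_real (d * (- sqrt z))) *
        gauss_int (\<kappa> * complex_of_real (d / (2 * sqrt l) + (- sqrt z) * sqrt l)) +
      exp (\<kappa>\<^sup>2 * complex_of_real (d * sqrt z)) *
        gauss_int (\<kappa> * complex_of_real (d / (2 * sqrt l) + sqrt z * sqrt l))))"
    by (simp add: fun_eq_iff phase_antideriv_def)
  ultimately show ?thesis
    using has_vector_derivative_mult_right[OF has_vector_derivative_add[OF part part],
       of "- sqrt z" "sqrt z" "- (2 / (\<kappa> * complex_of_real d))"] assms
    by (simp only:) simp
qed

section \<open>Limits of the primitive at both ends\<close>

lemma gauss_int_tendsto_at_bot:
  assumes "((\<lambda>x. gauss_int (\<kappa> * complex_of_real x)) \<longlongrightarrow> c) at_top"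
  shows "((\<lambda>x. gauss_int (\<kappa> * complex_of_real x)) \<longlongrightarrow> - c) at_bot"
proof -
  have "((\<lambda>x. - gauss_int (\<kappa> * complex_of_real (- x))) \<longlongrightarrow> - c) at_bot"
    by (intro tendsto_minus filterlim_compose[OF assms] filterlim_uminus_at_top_at_bot)
  thus ?thesis by (simp add: gauss_int_minus)
qed

text \<open>Near 0 the term \<open>d / (2 * sqrt l)\<close> dominates, so both real arguments tend
  to +infinity.\<close>

lemma phase_antideriv_tendsto_at_right_0:
  assumes "((\<lambda>x. gauss_int (\<kappa> * complex_of_real x)) \<longlongrightarrow> c) at_top" "d > 0" "z > 0"
  shows "(phase_antideriv \<kappa> d z \<longlongrightarrow> - (2 / (\<kappa> * complex_of_real d)) *
           (exp (- (\<kappa>\<^sup>2 * complex_of_real (d * sqrt z))) * c +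
            exp (\<kappa>\<^sup>2 * complex_of_real (d * sqrt z)) * c)) (at_right 0)"
  unfolding phase_antideriv_def
proof (intro tendsto_intros filterlim_compose[OF assms(1)])
  have "sqrt z > 0" using assms by simp
  show "LIM l at_right 0. d / (2 * sqrt l) - sqrt z * sqrt l :> at_top"
       "LIM l at_right 0. d / (2 * sqrt l) + sqrt z * sqrt l :> at_top"
    using \<open>d > 0\<close> \<open>sqrt z > 0\<close> by real_asymp+
qed

text \<open>At infinity \<open>sqrt z * sqrt l\<close> dominates, so the first argument changes
  direction and oddness of \<open>gauss_int\<close> yields \<open>- c\<close>.\<close>

lemma phase_antideriv_tendsto_at_top:
  assumes "((\<lambda>x. gauss_int (\<kappa> * complex_of_real x)) \<longlongrightarrow> c) at_top" "d > 0" "z > 0"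
  shows "(phase_antideriv \<kappa> d z \<longlongrightarrow> - (2 / (\<kappa> * complex_of_real d)) *
           (exp (- (\<kappa>\<^sup>2 * complex_of_real (d * sqrt z))) * (- c) +
            exp (\<kappa>\<^sup>2 * complex_of_real (d * sqrt z)) * c)) at_top"
  unfolding phase_antideriv_def
proof (intro tendsto_intros filterlim_compose[OF assms(1)]
         filterlim_compose[OF gauss_int_tendsto_at_bot[OF assms(1)]])
  have "sqrt z > 0" using assms by simp
  show "LIM l at_top. d / (2 * sqrt l) - sqrt z * sqrt l :> at_bot"
       "LIM l at_top. d / (2 * sqrt l) + sqrt z * sqrt l :> at_top"
    using \<open>d > 0\<close> \<open>sqrt z > 0\<close> by real_asymp+
qed

section \<open>Evaluation of the integral\<close>

theorem lemmaB1:
  fixes d z :: real and s :: nat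
  assumes "d > 0" and "z > 0" and "s \<in> {0, 1}"
  shows "has_phase_integral s (phase_integrand s d z)
           (inverse (c_coeff s d) *
            exp ((-1) ^ (s + 1) * \<i> ^ s * complex_of_real d * complex_of_real (sqrt z)))"
proof -
  \<comment> \<open>The phase of \<open>c_coeff\<close>; its square is (-\<i>)^s, so
    \<open>- \<kappa>\<^sup>2\<close> is exactly the phase in the exponent of the integrand.\<close>
  define \<kappa> where "\<kappa> = exp (- \<i> * of_nat s * complex_of_real pi / 4)"
  define c where "c = complex_of_real (sqrt pi / 2)"
  define F where "F = phase_antideriv \<kappa> d z"
  define f where "f = phase_integrand s d z"
  define w where "w = \<kappa>\<^sup>2 * complex_of_real (d * sqrt z)"
  define A where "A = - (2 / (\<kappa> * complex_of_real d)) * (exp (- w) * c + exp w * c)"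
  define B where "B = - (2 / (\<kappa> * complex_of_real d)) * (exp (- w) * (- c) + exp w * c)"
  have [simp]: "\<kappa> \<noteq> 0" by (simp add: \<kappa>_def)
  have lim: "((\<lambda>x. gauss_int (\<kappa> * complex_of_real x)) \<longlongrightarrow> c) at_top"
    using assms(3) gauss_int_tendsto_at_top gauss_int_tendsto_rotated by (auto simp: \<kappa>_def c_def)
  have A: "(F \<longlongrightarrow> A) (at_right 0)" and B: "(F \<longlongrightarrow> B) at_top"
    unfolding F_def A_def B_def w_def
    using phase_antideriv_tendsto_at_right_0[OF lim assms(1,2)]
          phase_antideriv_tendsto_at_top[OF lim assms(1,2)] by simp_all
  have "\<kappa>\<^sup>2 = exp (- (of_nat s * (\<i> * complex_of_real pi / 2)))"
    unfolding \<kappa>_def by (simp add: power2_eq_square exp_add[symmetric] field_simps)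
  also have "\<dots> = cis (- (pi / 2)) ^ s"
    by (simp add: cis_conv_exp exp_of_nat_mult[symmetric])
  finally have \<kappa>2: "- \<kappa>\<^sup>2 = (-1) ^ (s + 1) * \<i> ^ s"
    using assms(3) by (auto simp: cis.ctr complex_eq_iff)
  have BA: "B - A = inverse (c_coeff s d) *
            exp ((-1) ^ (s + 1) * \<i> ^ s * complex_of_real d * complex_of_real (sqrt z))"
  proof -
    \<comment> \<open>The \<open>exp w\<close> terms agree at both ends and cancel, while the
      \<open>exp (- w)\<close> terms have opposite signs and add up.\<close>
    have "B - A = 4 * c / (\<kappa> * complex_of_real d) * exp (- w)"
      using assms(1) unfolding A_def B_def by (simp add: field_simps)
    also have "- w = (-1) ^ (s + 1) * \<i> ^ s * complex_of_real d * complex_of_real (sqrt z)"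
      unfolding \<kappa>2[symmetric] w_def by simp
    also have "4 * c / (\<kappa> * complex_of_real d) = inverse (c_coeff s d)"
      by (simp add: c_coeff_def c_def \<kappa>_def field_simps)
    finally show ?thesis .
  qed
  have f_eq: "f l = exp (- (\<kappa>\<^sup>2 * complex_of_real (z * l + d\<^sup>2 / (4 * l)))) / complex_of_real (l powr (3/2))" for l
    unfolding f_def phase_integrand_def minus_mult_left \<kappa>2 by (simp only: add.commute)
  have F: "(F has_vector_derivative f l) (at l)" if "l > 0" for l
    using has_vector_derivative_phase_antideriv[of \<kappa> d z l] assms that by (simp add: F_def f_eq)
  have cont: "isCont f l" if "l > 0" for l
    unfolding f_eq[abs_def] using that by (intro continuous_intros) auto
  have "has_phase_integral s f (B - A)"
  proof (cases "s = 0")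
    case True
    \<comment> \<open>For s = 0 the integrand is real and nonnegative, so the fundamental theorem
      for nonnegative functions yields integrability and the value together from the end limits of
      \<open>Re F\<close>.\<close>
    define g where "g = (\<lambda>l. exp (- (z * l + d\<^sup>2 / (4 * l))) / l powr (3/2))"
    have fg: "f = (\<lambda>l. complex_of_real (g l))"
      using True by (auto simp: f_eq \<kappa>_def g_def exp_of_real[symmetric])
    have ein: "einterval 0 \<infinity> = {0<..}"
      by (auto simp: einterval_def)
    have lims: "(((\<lambda>l. Re (F l)) \<circ> real_of_ereal) \<longlongrightarrow> Re A) (at_right 0)"
               "(((\<lambda>l. Re (F l)) \<circ> real_of_ereal) \<longlongrightarrow> Re B) (at_left \<infinity>)"
      using tendsto_Re[OF A] tendsto_Re[OF B]
      by (simp_all add: zero_ereal_def ereal_tendsto_simps del: ereal_eq_0)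
    have der: "((\<lambda>l. Re (F l)) has_real_derivative g l) (at l)" if "0 < ereal l" for l
      using bounded_linear.has_vector_derivative[OF bounded_linear_Re F[of l]] that
      by (simp add: fg has_real_derivative_iff_has_vector_derivative)
    have gcont: "isCont g l" if "0 < ereal l" for l
      using that unfolding g_def by (intro continuous_intros) auto
    note FTC = interval_integral_FTC_nonneg[OF _ der gcont _ lims]
    have int: "set_integrable lborel {0<..} g"
      using FTC(1) by (simp add: ein g_def)
    have g_eq: "(LBINT l:{0<..}. g l) = Re B - Re A"
      using FTC(2) by (simp add: interval_lebesgue_integral_def ein g_def)
    \<comment> \<open>Only real parts have been evaluated so far; \<open>A\<close> and
      \<open>B\<close> are real because \<open>\<kappa>\<close> is 1.\<close>
    have k1: "\<kappa> = 1"
      using True by (simp add: \<kappa>_def)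
    have exps: "exp w \<in> \<real>" "exp (- w) \<in> \<real>"
      by (simp_all add: w_def k1 flip: of_real_mult of_real_minus exp_of_real)
    have "Im A = 0" "Im B = 0"
      using exps by (simp_all add: A_def B_def c_def k1 complex_is_Real_iff)
    with g_eq have "(LBINT l:{0<..}. f l) = B - A"
      by (simp add: fg set_integral_complex_of_real complex_eq_iff)
    moreover have "set_integrable lborel {0<..} f"
    proof -
      have "complex_integrable lborel (\<lambda>l. complex_of_real (indicator {0<..} l *\<^sub>R g l))"
        using int by (simp only: set_integrable_def complex_of_real_integrable_eq)
      thus ?thesis
        by (simp add: set_integrable_def fg scaleR_conv_of_real)
    qed
    ultimately show ?thesis
      using True by (simp add: has_phase_integral_def)
  next
    case False
    have cont': "continuous_on {\<epsilon>..L} f" if "0 < \<epsilon>" for \<epsilon> L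
      using cont that by (intro continuous_at_imp_continuous_on) auto
    \<comment> \<open>Each term depends on one variable only, so the two one-sided limits combine
      along the product filter.\<close>
    have "((\<lambda>(\<epsilon>, L). F L - F \<epsilon>) \<longlongrightarrow> B - A) (at_right 0 \<times>\<^sub>F at_top)"
      unfolding case_prod_unfold
      by (intro tendsto_diff filterlim_compose[OF A filterlim_fst] filterlim_compose[OF B filterlim_snd])
    moreover have "\<forall>\<^sub>F (\<epsilon>, L) in at_right 0 \<times>\<^sub>F at_top. F L - F \<epsilon> = (LBINT l:{\<epsilon>..L}. f l)"
    proof -
      \<comment> \<open>The threshold 1 separates the variables: it holds eventually in each of them
        and forces \<open>\<epsilon> \<le> L\<close>.\<close>
      have FTC: "F L - F \<epsilon> = (LBINT l:{\<epsilon>..L}. f l)" if "0 < \<epsilon>" "\<epsilon> < 1" "1 \<le> L" for \<epsilon> L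
        unfolding set_lebesgue_integral_def using that
        by (intro integral_FTC_atLeastAtMost[symmetric] cont')
           (simp_all add: has_vector_derivative_at_within[OF F])
      have "\<forall>\<^sub>F \<epsilon> in at_right 0. 0 < \<epsilon> \<and> \<epsilon> < (1::real)"
        by (auto simp: eventually_at_right_field intro!: exI[of _ 1])
      from eventually_prodI[OF this eventually_ge_at_top[of 1]]
      have "\<forall>\<^sub>F (p::real \<times> real) in at_right 0 \<times>\<^sub>F at_top. (0 < fst p \<and> fst p < 1) \<and> 1 \<le> snd p" .
      thus ?thesis
        unfolding case_prod_unfold by eventually_elim (auto intro: FTC)
    qed
    ultimately have "((\<lambda>(\<epsilon>, L). LBINT l:{\<epsilon>..L}. f l) \<longlongrightarrow> B - A) (at_right 0 \<times>\<^sub>F at_top)"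
      by (auto intro: Lim_transform_eventually simp: case_prod_unfold)
    thus ?thesis
      using False borel_integrable_atLeastAtMost'[OF cont']
      by (simp add: has_phase_integral_def has_improper_integral_0_inf_def)
  qed
  thus ?thesis unfolding BA f_def .
qed

end
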